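(* Let $\tau>0$ be such that $$D:=\begin{bmatrix}\tau^{-1}I_{nN}&0\\-2A&\tau^{-1}I_m\end{bmatrix}$$ satisfies $D\succ0$ (i.e. $z^\top Dz>0$ for all $z\ne0$). Let $\mathcal C:=\boldsymbol\Omega\times\mathbb R^m_{\ge0}$, $$\mathcal R:\begin{bmatrix}\boldsymbol x\\ \lambda\end{bmatrix}\mapsto\begin{bmatrix}F(\boldsymbol x)\\ b\end{bmatrix}+\begin{bmatrix}0&A^\top\\-A&0\end{bmatrix}\begin{bmatrix}\boldsymbol x\\ \lambda\end{bmatrix},$$ and, given $\boldsymbol\omega^k=\mathrm{col}(\boldsymbol x^k,\lambda^k)$, let $\mathcal R^k_D(\boldsymbol\omega):=\mathcal R(\boldsymbol\omega^k)+D(\boldsymbol\omega-\boldsymbol\omega^k)$. Then the asymmetric projection iteration $$\boldsymbol\omega^{k+1}=\text{ the (unique) solution to } \mathrm{VI}(\mathcal C,\mathcal R^k_D)$$ equivalently reads as $$\boldsymbol\omega^{k+1}=(\mathrm{Id}+D^{-1}\mathrm N_{\mathcal C})^{-1}\circ(\mathrm{Id}-D^{-1}\mathcal R)(\boldsymbol\omega^k),$$ i.e. it is the preconditioned forward-backward iteration for the splitting $T=\mathrm N_{\mathcal C}+\mathcal R$ with preconditioning matrix $D$. Moreover, this iteration coincides with the iteration $$\boldsymbol x^{k+1}=\mathrm{proj}_{\boldsymbol\Omega}\big[\boldsymbol x^k-\tau(F(\boldsymbol x^k)+A^\top\lambda^k)\big],\qquad \lambda^{k+1}=\mathrm{proj}_{\mathbb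 R^m_{\ge0}}\big[\lambda^k+\tau(2A\boldsymbol x^{k+1}-A\boldsymbol x^k-b)\big].$$
   Context: Setting. Let $N,n,m\ge1$ and $\mathcal N=\{1,\dots,N\}$. Each agent $i\in\mathcal N$ has a decision set $\Omega_i\subseteq\mathbb R^n$; $\boldsymbol\Omega:=\Omega_1\times\cdots\times\Omega_N$, $\boldsymbol x=\mathrm{col}(x_1,\dots,x_N)\in\mathbb R^{nN}$, and $\boldsymbol x_{-i}$ stacks the $x_j$, $j\neq i$. Agent $i$ has cost $J_i(x_i,\boldsymbol x_{-i})=f_i\big(x_i,\frac1N\sum_jx_j\big)$. Coupling constraints: $A\boldsymbol x\le b$ with $A\in\mathbb R^{m\times nN}$, $b\in\mathbb R^m$; $\boldsymbol{\mathcal X}:=\boldsymbol\Omega\cap\{\boldsymbol y:A\boldsymbol y\le b\}$. Standing assumptions. (1) For each $i$ and $\boldsymbol y\in\mathbb R^{n(N-1)}$, $J_i(\cdot,\boldsymbol y)$ is convex and continuously differentiable. (2) Each $\Omega_i$ is nonempty, compact and convex, and $\boldsymbol{\mathcal X}$ satisfies Slater's constraint qualification (there is $\hat{\boldsymbol x}\in\boldsymbol\Omega$ with $A\hat{\boldsymbol x}<b$ componentwise). (3) The pseudo-gradient $F:\mathbb R^{nN}\to\mathbb R^{nN}$, $F(\boldsymbol x)=\mathrm{col}(\{\nabla_{x_i}J_i(x_i,\boldsymbol x_{-i})\}_{i\in\mathcal N})$, is $\eta$-strongly monotone and $\ell_F$-Lipschitz continuous, $\eta,\ell_F>0$. Notation.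 For a closed convex set $S\subseteq\mathbb R^p$ and $\psi:S\to\mathbb R^p$, a solution of the variational inequality $\mathrm{VI}(S,\psi)$ is a point $x^*\in S$ with $(x-x^* )^\top\psi(x^* )\ge0$ for all $x\in S$. $\mathrm N_S(x)=\{v:\sup_{z\in S}v^\top(z-x)\le0\}$ if $x\in S$, $\varnothing$ otherwise. $\mathrm{proj}_S$ is the Euclidean projection. $T$ is the set-valued mapping $$T:\begin{bmatrix}\boldsymbol x\\ \mu\end{bmatrix}\mapsto\begin{bmatrix}\mathrm N_{\boldsymbol\Omega}(\boldsymbol x)+F(\boldsymbol x)+A^\top\mu\\ \mathrm N_{\mathbb R^m_{\ge0}}(\mu)-(A\boldsymbol x-b)\end{bmatrix}.$$ For a splitting $T=\mathcal A+\mathcal B$ and an invertible matrix $\Phi$, the preconditioned forward-backward iteration is $\boldsymbol\omega^{k+1}=(\mathrm{Id}+\Phi^{-1}\mathcal B)^{-1}\circ(\mathrm{Id}-\Phi^{-1}\mathcal A)(\boldsymbol\omega^k)$. *)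

theory Defs
  imports "HOL-Analysis.Analysis" "HOL-Library.Set_Algebras"
begin

text \<open>Stacked vectors: \<open>\<real>\<^sup>p \<times> \<real>\<^sup>q\<close> is identified with \<open>\<real>\<^sup>p\<^sup>+\<^sup>q\<close>, whose index type is a sum,
  and \<open>\<real>\<^sup>n\<^sup>N\<close> is indexed by pairs (agent, coordinate).\<close>

definition col :: "real ^ 'p \<Rightarrow> real ^ 'q \<Rightarrow> real ^ ('p + 'q)" where
  "col x y = (\<chi> s. case s of Inl i \<Rightarrow> x $ i | Inr j \<Rightarrow> y $ j)"

definition col_fst :: "real ^ ('p::finite + 'q::finite) \<Rightarrow> real ^ 'p" where
  "col_fst w = (\<chi> i. w $ Inl i)"

definition col_snd :: "real ^ ('p::finite + 'q::finite) \<Rightarrow> real ^ 'q" where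
  "col_snd w = (\<chi> j. w $ Inr j)"

definition col_prod :: "(real ^ 'p) set \<Rightarrow> (real ^ 'q) set \<Rightarrow> (real ^ ('p + 'q)) set" where
  "col_prod S S' = {col x y | x y. x \<in> S \<and> y \<in> S'}"

definition block_mat ::
  "real ^ 'p ^ 'r \<Rightarrow> real ^ 'q ^ 'r \<Rightarrow> real ^ 'p ^ 's \<Rightarrow> real ^ 'q ^ 's \<Rightarrow> real ^ ('p + 'q) ^ ('r + 's)" where
  "block_mat P Q P' Q' =
     (\<chi> s. case s of Inl i \<Rightarrow> col (P $ i) (Q $ i) | Inr j \<Rightarrow> col (P' $ j) (Q' $ j))"

definition agent_block :: "'N \<Rightarrow> real ^ ('N::finite \<times> 'n::finite) \<Rightarrow> real ^ 'n" where
  "agent_block i x = (\<chi> k. x $ (i, k))"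

definition joint_set :: "('N::finite \<Rightarrow> (real ^ 'n::finite) set) \<Rightarrow> (real ^ ('N \<times> 'n)) set" where
  "joint_set \<Omega> = {x. \<forall>i. agent_block i x \<in> \<Omega> i}"

definition nonneg_orthant :: "(real ^ 'm) set" where
  "nonneg_orthant = {\<mu>. \<forall>j. 0 \<le> \<mu> $ j}"

text \<open>The game. The type of the opponents' profile \<open>x\<^sub>-\<^sub>i\<close> would depend on \<open>i\<close>; it is given here as a
  full profile \<open>y\<close> whose \<open>i\<close>-th block is ignored.\<close>

definition agent_cost ::
  "('N::finite \<Rightarrow> real ^ 'n::finite \<Rightarrow> real ^ 'n \<Rightarrow> real) \<Rightarrow> 'N \<Rightarrow> real ^ 'n \<Rightarrow> real ^ ('N \<times> 'n) \<Rightarrow> real" where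
  "agent_cost f i u y =
     f i u ((1 / real CARD('N)) *\<^sub>R (\<Sum>j\<in>UNIV. if j = i then u else agent_block j y))"

definition gradient :: "(real ^ 'n \<Rightarrow> real) \<Rightarrow> real ^ 'n \<Rightarrow> real ^ 'n" where
  "gradient g u = (THE v. GDERIV g u :> v)"

definition continuously_differentiable :: "(real ^ 'n \<Rightarrow> real) \<Rightarrow> bool" where
  "continuously_differentiable g \<longleftrightarrow>
     (\<forall>u. g differentiable (at u)) \<and> continuous_on UNIV (gradient g)"

definition pseudo_gradient ::
  "('N::finite \<Rightarrow> real ^ 'n::finite \<Rightarrow> real ^ 'n \<Rightarrow> real) \<Rightarrow> real ^ ('N \<times> 'n) \<Rightarrow> real ^ ('N \<times> 'n)" where
  "pseudo_gradient f x =
     (\<chi> s. case s of (i, k) \<Rightarrow> gradient (\<lambda>u. agent_cost f i u x) (agent_block i x) $ k)"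

definition strongly_monotone :: "real \<Rightarrow> (real ^ 'p \<Rightarrow> real ^ 'p) \<Rightarrow> bool" where
  "strongly_monotone \<eta> F \<longleftrightarrow> (\<forall>x y. \<eta> * (norm (x - y))\<^sup>2 \<le> (x - y) \<bullet> (F x - F y))"

definition slater :: "(real ^ 'p) set \<Rightarrow> real ^ 'p ^ 'm \<Rightarrow> real ^ 'm \<Rightarrow> bool" where
  "slater S A b \<longleftrightarrow> (\<exists>x\<in>S. \<forall>j. (A *v x) $ j < b $ j)"

definition pos_def :: "real ^ 'p ^ 'p \<Rightarrow> bool" where
  "pos_def M \<longleftrightarrow> (\<forall>z. z \<noteq> 0 \<longrightarrow> 0 < z \<bullet> (M *v z))"

definition vi_solution :: "(real ^ 'p) set \<Rightarrow> (real ^ 'p \<Rightarrow> real ^ 'p) \<Rightarrow> real ^ 'p \<Rightarrow> bool" where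
  "vi_solution S \<psi> w \<longleftrightarrow> w \<in> S \<and> (\<forall>z\<in>S. 0 \<le> (z - w) \<bullet> \<psi> w)"

text \<open>The supremum is taken in the extended reals, since it may be infinite.\<close>

definition normal_cone :: "(real ^ 'p) set \<Rightarrow> real ^ 'p \<Rightarrow> (real ^ 'p) set" where
  "normal_cone S x = (if x \<in> S then {v. (SUP z\<in>S. ereal (v \<bullet> (z - x))) \<le> 0} else {})"

text \<open>Set-valued operators \<open>\<real>\<^sup>p \<rightrightarrows> \<real>\<^sup>p\<close>; sums of sets are Minkowski sums.\<close>

definition op_of :: "(real ^ 'p \<Rightarrow> real ^ 'p) \<Rightarrow> real ^ 'p \<Rightarrow> (real ^ 'p) set" where
  "op_of G w = {G w}"

definition op_add ::
  "(real ^ 'p \<Rightarrow> (real ^ 'p) set) \<Rightarrow> (real ^ 'p \<Rightarrow> (real ^ 'p) set) \<Rightarrow> real ^ 'p \<Rightarrow> (real ^ 'p) set" where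
  "op_add P Q w = P w + Q w"

definition op_mat :: "real ^ 'p ^ 'p \<Rightarrow> (real ^ 'p \<Rightarrow> (real ^ 'p) set) \<Rightarrow> real ^ 'p \<Rightarrow> (real ^ 'p) set" where
  "op_mat M P w = (*v) M ` P w"

definition op_minus :: "(real ^ 'p \<Rightarrow> (real ^ 'p) set) \<Rightarrow> real ^ 'p \<Rightarrow> (real ^ 'p) set" where
  "op_minus P w = uminus ` P w"

definition op_inv :: "(real ^ 'p \<Rightarrow> (real ^ 'p) set) \<Rightarrow> real ^ 'p \<Rightarrow> (real ^ 'p) set" where
  "op_inv P v = {w. v \<in> P w}"

definition op_comp ::
  "(real ^ 'p \<Rightarrow> (real ^ 'p) set) \<Rightarrow> (real ^ 'p \<Rightarrow> (real ^ 'p) set) \<Rightarrow> real ^ 'p \<Rightarrow> (real ^ 'p) set" where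
  "op_comp P Q w = (\<Union>v\<in>Q w. P v)"

text \<open>\<open>(Id + \<Phi>\<^sup>-\<^sup>1 \<B>)\<^sup>-\<^sup>1 \<circ> (Id - \<Phi>\<^sup>-\<^sup>1 \<A>)\<close>, with \<open>\<A>\<close> the forward and \<open>\<B>\<close> the backward operator.\<close>

definition precond_fb ::
  "real ^ 'p ^ 'p \<Rightarrow> (real ^ 'p \<Rightarrow> (real ^ 'p) set) \<Rightarrow> (real ^ 'p \<Rightarrow> (real ^ 'p) set) \<Rightarrow>
   real ^ 'p \<Rightarrow> (real ^ 'p) set" where
  "precond_fb \<Phi> \<A> \<B> =
     op_comp (op_inv (op_add (op_of id) (op_mat (matrix_inv \<Phi>) \<B>)))
             (op_add (op_of id) (op_minus (op_mat (matrix_inv \<Phi>) \<A>)))"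

definition kkt_op ::
  "(real ^ 'p) set \<Rightarrow> (real ^ 'p \<Rightarrow> real ^ 'p) \<Rightarrow> real ^ 'p ^ 'm \<Rightarrow> real ^ 'm \<Rightarrow>
   real ^ ('p + 'm) \<Rightarrow> (real ^ ('p + 'm)) set" where
  "kkt_op S F A b w =
     col_prod (normal_cone S (col_fst w) + {F (col_fst w)} + {transpose A *v col_snd w})
              (normal_cone nonneg_orthant (col_snd w) + {- (A *v col_fst w - b)})"

definition precond_D :: "real \<Rightarrow> real ^ 'p ^ 'm \<Rightarrow> real ^ ('p + 'm) ^ ('p + 'm)" where
  "precond_D \<tau> A = block_mat (mat (inverse \<tau>)) 0 ((-2) *\<^sub>R A) (mat (inverse \<tau>))"

definition op_R ::
  "(real ^ 'p \<Rightarrow> real ^ 'p) \<Rightarrow> real ^ 'p ^ 'm \<Rightarrow> real ^ 'm \<Rightarrow> real ^ ('p + 'm) \<Rightarrow> real ^ ('p + 'm)" where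
  "op_R F A b w = col (F (col_fst w)) b + block_mat 0 (transpose A) (- A) 0 *v w"

text \<open>The map \<open>\<R>\<^sup>k\<^sub>D\<close> attached to the current iterate \<open>wk\<close>.\<close>

definition op_RD ::
  "(real ^ 'p \<Rightarrow> real ^ 'p) \<Rightarrow> real ^ 'p ^ 'm \<Rightarrow> real ^ 'm \<Rightarrow> real \<Rightarrow>
   real ^ ('p + 'm) \<Rightarrow> real ^ ('p + 'm) \<Rightarrow> real ^ ('p + 'm)" where
  "op_RD F A b \<tau> wk w = op_R F A b wk + precond_D \<tau> A *v (w - wk)"

end

(*
  The variational inequality says that R(w_k) + D(w - w_k) lies in the negative normal cone of C at w;
  since D is invertible, this inclusion is the resolvent equation of the forward-backward step.
  D is block lower triangular and C is a product, so the inequality splits into one for x that does not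
  involve the multiplier and, once x is known, one for the multiplier. Both are the variational
  characterisation of a projection.
*)
theory Submission
  imports Defs
begin

section \<open>Stacked vectors and block matrices\<close>

lemma col_fst_col [simp]: "col_fst (col x y) = x"
  by (simp add: col_fst_def col_def)

lemma col_snd_col [simp]: "col_snd (col x y) = y"
  by (simp add: col_snd_def col_def)

lemma col_fst_snd [simp]: "col (col_fst w) (col_snd w) = w"
  by (auto simp: col_fst_def col_snd_def col_def vec_eq_iff split: sum.splits)

lemma col_add: "col x y + col u v = col (x + u) (y + v)"
  by (auto simp: col_def vec_eq_iff split: sum.splits)

lemma col_diff: "col x y - col u v = col (x - u) (y - v)"
  by (auto simp: col_def vec_eq_iff split: sum.splits)

lemma sum_UNIV_sum_type:
  fixes g :: "'p::finite + 'q::finite \<Rightarrow> 'a::comm_monoid_add"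
  shows "(\<Sum>s\<in>UNIV. g s) = (\<Sum>i\<in>UNIV. g (Inl i)) + (\<Sum>j\<in>UNIV. g (Inr j))"
  by (subst UNIV_Plus_UNIV[symmetric]) (simp add: sum.Plus o_def del: UNIV_Plus_UNIV)

lemma inner_col: "col x y \<bullet> col u v = x \<bullet> u + y \<bullet> v"
  by (simp add: inner_vec_def sum_UNIV_sum_type col_def)

lemma block_mat_mult_col:
  "block_mat P Q P' Q' *v col x y = col (P *v x + Q *v y) (P' *v x + Q' *v y)"
  by (auto simp: vec_eq_iff block_mat_def matrix_vector_mult_def sum_UNIV_sum_type col_def
      split: sum.splits)

lemma mem_col_prod_iff: "w \<in> col_prod S S' \<longleftrightarrow> col_fst w \<in> S \<and> col_snd w \<in> S'"
  by (auto simp: col_prod_def) (metis col_fst_snd)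

lemma ball_col_prod: "(\<forall>w\<in>col_prod S S'. P w) \<longleftrightarrow> (\<forall>x\<in>S. \<forall>y\<in>S'. P (col x y))"
  by (auto simp: col_prod_def)

text \<open>Turns a Minkowski sum with a single-valued operator into a translated membership, as
  needed for \<open>kkt_op\<close> and \<open>op_add\<close>.\<close>

lemma mem_plus_singleton_iff:
  fixes X :: "'a::ab_group_add set"
  shows "v \<in> X + {a} \<longleftrightarrow> v - a \<in> X"
proof
  assume "v - a \<in> X"
  then have "(v - a) + a \<in> X + {a}" by (intro set_plus_intro) auto
  then show "v \<in> X + {a}" by simp
qed (auto elim: set_plus_elim)

section \<open>Normal cones and Euclidean projections\<close>

lemma normal_cone_iff: "v \<in> normal_cone S x \<longleftrightarrow> x \<in> S \<and> (\<forall>z\<in>S. v \<bullet> (z - x) \<le> 0)"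
  by (simp add: normal_cone_def SUP_le_iff)

lemma vi_solution_iff_normal_cone: "vi_solution S \<psi> w \<longleftrightarrow> - \<psi> w \<in> normal_cone S w"
  by (auto simp: vi_solution_def normal_cone_iff inner_commute)

lemma normal_cone_col_prod:
  "normal_cone (col_prod S S') w = col_prod (normal_cone S (col_fst w)) (normal_cone S' (col_snd w))"
proof -
  obtain x y where w: "w = col x y" by (metis col_fst_snd)
  have "v \<in> normal_cone (col_prod S S') w \<longleftrightarrow>
    v \<in> col_prod (normal_cone S (col_fst w)) (normal_cone S' (col_snd w))" for v
  proof -
    obtain p q where v: "v = col p q" by (metis col_fst_snd)
    have "(\<forall>z\<in>S. \<forall>z'\<in>S'. p \<bullet> (z - x) + q \<bullet> (z' - y) \<le> 0) \<longleftrightarrow>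
        (\<forall>z\<in>S. p \<bullet> (z - x) \<le> 0) \<and> (\<forall>z'\<in>S'. q \<bullet> (z' - y) \<le> 0)" (is "?L \<longleftrightarrow> ?R")
      if "x \<in> S" "y \<in> S'"
    proof
      assume ?L
      \<comment> \<open>Testing with \<open>z' = y\<close>, respectively \<open>z = x\<close>, kills
        one of the two terms; both points are admissible because the base point lies in the product.
        Off the product both cones are empty.\<close>
      with that show ?R by (metis add.right_neutral add.left_neutral diff_self inner_zero_right)
    qed (force intro: add_nonpos_nonpos)
    then show ?thesis
      by (auto simp: w v normal_cone_iff mem_col_prod_iff ball_col_prod col_diff inner_col)
  qed
  then show ?thesis by blast
qed

text \<open>A cone is invariant under positive scaling, so the step size can be divided out of an
  inclusion.\<close>

lemma normal_cone_scaleR_iff: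
  assumes "0 < c"
  shows "c *\<^sub>R v \<in> normal_cone S x \<longleftrightarrow> v \<in> normal_cone S x"
  using assms by (simp add: normal_cone_iff mult_le_0_iff)

text \<open>The obtuse-angle criterion for projections. It links the variational inequality to the
  explicit update formulas.\<close>

lemma closest_point_iff_normal_cone:
  fixes S :: "(real ^ 'p) set"
  assumes "convex S" "closed S" "S \<noteq> {}"
  shows "p = closest_point S a \<longleftrightarrow> a - p \<in> normal_cone S p"
proof
  assume "p = closest_point S a"
  then show "a - p \<in> normal_cone S p"
    using assms by (auto simp: normal_cone_iff closest_point_in_set closest_point_dot)
next
  assume *: "a - p \<in> normal_cone S p"
  have "dist a p \<le> dist a z" if "z \<in> S" for z
  proof -
    have "(a - p) \<bullet> (z - p) \<le> 0" using * that by (simp add: normal_cone_iff)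
    \<comment> \<open>Expand |a - z|^2 = |a - p|^2 - 2 (a - p).(z - p) + |z - p|^2; the last two
      terms are nonnegative.\<close>
    then have "(norm (a - p))\<^sup>2 \<le> (norm (a - z))\<^sup>2"
      using zero_le_power2[of "norm (z - p)"]
      unfolding power2_norm_eq_inner by (simp add: inner_diff inner_commute algebra_simps)
    then show ?thesis by (simp add: dist_norm)
  qed
  with * assms show "p = closest_point S a"
    by (intro closest_point_unique) (auto simp: normal_cone_iff)
qed

text \<open>The obtuse-angle criterion in the shape of one row of \<open>op_RD\<close>:
  \<open>g\<close> is the forward part and \<open>inverse t\<close> is the diagonal block of D. The
  vector from \<open>p\<close> to the projected point is \<open>t\<close> times the negated row, and
  the factor \<open>t\<close> drops out of the cone.\<close>

lemma closest_point_iff_vi_residual: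
  fixes S :: "(real ^ 'p) set"
  assumes "convex S" "closed S" "S \<noteq> {}" "0 < t"
  shows "p = closest_point S (a - t *\<^sub>R g) \<longleftrightarrow> - (g + inverse t *\<^sub>R (p - a)) \<in> normal_cone S p"
proof -
  have "a - t *\<^sub>R g - p = t *\<^sub>R (- (g + inverse t *\<^sub>R (p - a)))"
    using assms(4) by (simp add: algebra_simps)
  then show ?thesis
    by (simp only: closest_point_iff_normal_cone[OF assms(1-3)] normal_cone_scaleR_iff[OF assms(4)])
qed

section \<open>Closedness and convexity of the constraint sets\<close>

lemma convex_nonneg_orthant: "convex nonneg_orthant"
  by (auto simp: nonneg_orthant_def convex_def)

lemma closed_nonneg_orthant: "closed nonneg_orthant"
  unfolding nonneg_orthant_def by (intro closed_Collect_all closed_Collect_le continuous_intros)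

lemma nonneg_orthant_nonempty: "nonneg_orthant \<noteq> {}"
  by (auto simp: nonneg_orthant_def intro!: exI[of _ 0])

lemma agent_block_scaleR_add:
  "agent_block i (u *\<^sub>R x + v *\<^sub>R y) = u *\<^sub>R agent_block i x + v *\<^sub>R agent_block i y"
  by (simp add: agent_block_def vec_eq_iff)

lemma convex_joint_set: "(\<And>i. convex (\<Omega> i)) \<Longrightarrow> convex (joint_set \<Omega>)"
  by (auto simp: joint_set_def convex_def agent_block_scaleR_add)

lemma closed_joint_set:
  assumes "\<And>i. closed (\<Omega> i)"
  shows "closed (joint_set \<Omega>)"
proof -
  have "joint_set \<Omega> = (\<Inter>i. agent_block i -` \<Omega> i)" by (auto simp: joint_set_def)
  moreover have "continuous_on UNIV (agent_block i)" for i :: 'a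
    unfolding agent_block_def by (intro continuous_intros)
  ultimately show ?thesis using assms by (auto intro!: closed_INT closed_vimage)
qed

section \<open>The preconditioned step as a normal-cone inclusion\<close>

lemma pos_def_invertible:
  assumes "pos_def M"
  shows "invertible M"
proof -
  \<comment> \<open>A kernel vector makes the quadratic form vanish. Symmetry is not part of
    \<open>pos_def\<close>, which suits the block triangular D.\<close>
  have "x = 0" if "M *v x = 0" for x
    using assms that by (force simp: pos_def_def)
  then show ?thesis
    by (simp add: invertible_left_inverse matrix_left_invertible_ker)
qed

text \<open>Multiplying the resolvent equation by D determines the element of \<open>B w'\<close>
  that occurs in it. \<open>B\<close> is an arbitrary set-valued operator, so this is pure
  algebra.\<close>

lemma mem_precond_fb_iff:
  assumes "invertible D"
  shows "w' \<in> precond_fb D (op_of G) B w \<longleftrightarrow> - (G w + D *v (w' - w)) \<in> B w'"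
proof -
  let ?I = "matrix_inv D"
  \<comment> \<open>\<open>matrix_inv\<close> is defined by choice; invertibility makes the chosen
    matrix a two-sided inverse.\<close>
  have DI: "D *v (?I *v z) = z" and ID: "?I *v (D *v z) = z" for z
    using someI_ex[OF assms[unfolded invertible_def]]
    by (simp_all add: matrix_vector_mul_assoc matrix_inv_def)
  have "w' \<in> precond_fb D (op_of G) B w \<longleftrightarrow> (\<exists>v\<in>B w'. w - ?I *v G w = w' + ?I *v v)"
    by (auto simp: precond_fb_def op_comp_def op_inv_def op_add_def op_of_def op_mat_def op_minus_def
        set_plus_def)
  also have "\<dots> \<longleftrightarrow> (\<exists>v\<in>B w'. v = - (G w + D *v (w' - w)))"
  proof -
    have "w - ?I *v G w = w' + ?I *v v \<longleftrightarrow> v = - (G w + D *v (w' - w))" for v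
    proof
      assume "w - ?I *v G w = w' + ?I *v v"
      then have "D *v (w - ?I *v G w) = D *v (w' + ?I *v v)" by simp
      then show "v = - (G w + D *v (w' - w))"
        by (simp add: matrix_vector_right_distrib matrix_vector_mult_diff_distrib DI algebra_simps)
    next
      assume "v = - (G w + D *v (w' - w))"
      then have "v = D *v (w - w') - G w"
        by (simp add: matrix_vector_mult_diff_distrib)
      then show "w - ?I *v G w = w' + ?I *v v"
        by (simp add: matrix_vector_mult_diff_distrib ID)
    qed
    then show ?thesis by simp
  qed
  finally show ?thesis by simp
qed

section \<open>Block form of the operators of the game\<close>

lemma matrix_vector_mult_minus: "(- A) *v x = - (A *v x)"
  for A :: "real ^ 'p ^ 'm"
  by (simp add: vec_eq_iff matrix_vector_mult_def sum_negf)

lemma op_R_col: "op_R F A b (col x l) = col (F x + transpose A *v l) (b - A *v x)"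
  by (simp add: op_R_def block_mat_mult_col col_add matrix_vector_mult_minus)

text \<open>The zero block of D keeps \<open>l'\<close> out of the first row. In the second row the
  block -2A, applied to \<open>x' - x\<close>, turns -A x into A x - 2 A x', which is the source of
  the extrapolation 2 x' - x in the multiplier update.\<close>

lemma op_RD_col:
  "op_RD F A b \<tau> (col x l) (col x' l') =
     col ((F x + transpose A *v l) + inverse \<tau> *\<^sub>R (x' - x))
         ((b + A *v x - 2 *\<^sub>R (A *v x')) + inverse \<tau> *\<^sub>R (l' - l))"
proof -
  have *: "mat c *v z = c *\<^sub>R z" for c :: real and z :: "real ^ 'k"
    by (simp add: vec_eq_iff matrix_vector_mult_def mat_def if_distrib if_distribR
        cong: if_cong)
  have "b - A *v x - 2 *\<^sub>R (A *v (x' - x)) = b + A *v x - 2 *\<^sub>R (A *v x')"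
    by (simp add: matrix_vector_mult_diff_distrib algebra_simps scaleR_2)
  moreover have "(- 2) *\<^sub>R A *v (x' - x) = - (2 *\<^sub>R (A *v (x' - x)))"
    by (simp only: scaleR_matrix_vector_assoc scaleR_minus_left matrix_vector_mult_minus)
  ultimately have "b - A *v x + ((- 2) *\<^sub>R A *v (x' - x) + z) = b + A *v x - 2 *\<^sub>R (A *v x') + z" for z
    by (simp only: add.assoc[symmetric] diff_conv_add_uminus)
  then show ?thesis
    unfolding op_RD_def op_R_col precond_D_def col_diff block_mat_mult_col col_add *
    by (simp only: matrix_vector_mult_0 add_0_right)
qed

text \<open>The cone of the product gives the two cone terms of T; the skew-symmetric block of R
  gives the coupling terms.\<close>

lemma kkt_op_eq_normal_cone_plus_op_R:
  fixes A :: "real ^ 'p ^ 'm"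
  shows "kkt_op S F A b = op_add (normal_cone (col_prod S nonneg_orthant)) (op_of (op_R F A b))"
proof (intro ext set_eqI)
  fix w v :: "real ^ ('p + 'm)"
  obtain x l p q where w: "w = col x l" and v: "v = col p q" by (metis col_fst_snd)
  show "v \<in> kkt_op S F A b w \<longleftrightarrow>
      v \<in> op_add (normal_cone (col_prod S nonneg_orthant)) (op_of (op_R F A b)) w"
    by (simp add: w v kkt_op_def op_add_def op_of_def op_R_col mem_plus_singleton_iff
        mem_col_prod_iff normal_cone_col_prod col_diff) (simp add: algebra_simps)
qed

lemma vi_solution_op_RD_iff_projections:
  fixes S :: "(real ^ 'p) set"
  assumes "convex S" "closed S" "S \<noteq> {}" "0 < \<tau>"
  shows "vi_solution (col_prod S nonneg_orthant) (op_RD F A b \<tau> (col x l)) (col x' l') \<longleftrightarrow>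
    x' = closest_point S (x - \<tau> *\<^sub>R (F x + transpose A *v l)) \<and>
    l' = closest_point nonneg_orthant (l + \<tau> *\<^sub>R (2 *\<^sub>R (A *v x') - A *v x - b))"
proof -
  have minus: "- col u v = col (- u) (- v)" for u :: "real ^ 'p" and v :: "real ^ 'b"
    by (auto simp: col_def vec_eq_iff split: sum.splits)
  \<comment> \<open>Rewrites the argument of the multiplier projection as a gradient step along the
    second row of \<open>op_RD_col\<close>, so that the residual form applies to it.\<close>
  have "l + \<tau> *\<^sub>R (2 *\<^sub>R (A *v x') - A *v x - b) = l - \<tau> *\<^sub>R (b + A *v x - 2 *\<^sub>R (A *v x'))"
    by (simp add: algebra_simps)
  then show ?thesis
    unfolding vi_solution_iff_normal_cone op_RD_col normal_cone_col_prod minus mem_col_prod_iff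
    by (simp only: col_fst_col col_snd_col closest_point_iff_vi_residual[OF assms]
        closest_point_iff_vi_residual[OF convex_nonneg_orthant closed_nonneg_orthant
          nonneg_orthant_nonempty assms(4)])
qed

theorem mainTheorem3:
  fixes f :: "'N::finite \<Rightarrow> real ^ 'n::finite \<Rightarrow> real ^ 'n \<Rightarrow> real"
    and \<Omega> :: "'N \<Rightarrow> (real ^ 'n) set"
    and A :: "real ^ ('N \<times> 'n) ^ 'm::finite"
    and b :: "real ^ 'm"
    and \<eta> L \<tau> :: real
  defines "F \<equiv> pseudo_gradient f"
    and "C \<equiv> col_prod (joint_set \<Omega>) nonneg_orthant"
    and "D \<equiv> precond_D \<tau> A"
  assumes cost_convex: "\<And>i y. convex_on UNIV (\<lambda>u. agent_cost f i u y)"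
    and cost_C1: "\<And>i y. continuously_differentiable (\<lambda>u. agent_cost f i u y)"
    and Omega_nonempty: "\<And>i. \<Omega> i \<noteq> {}"
    and Omega_compact: "\<And>i. compact (\<Omega> i)"
    and Omega_convex: "\<And>i. convex (\<Omega> i)"
    and slater: "slater (joint_set \<Omega>) A b"
    and eta: "0 < \<eta>" "strongly_monotone \<eta> F"
    and lipschitz: "0 < L" "L-lipschitz_on UNIV F"
    and tau: "0 < \<tau>"
    and D_pos: "pos_def D"
  shows "(\<forall>wk. \<exists>!w. vi_solution C (op_RD F A b \<tau> wk) w)
    \<and> invertible D
    \<and> kkt_op (joint_set \<Omega>) F A b = op_add (normal_cone C) (op_of (op_R F A b))
    \<and> (\<forall>w k. vi_solution C (op_RD F A b \<tau> (w k)) (w (Suc k))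
          \<longleftrightarrow> precond_fb D (op_of (op_R F A b)) (normal_cone C) (w k) = {w (Suc k)})
    \<and> (\<forall>x l k. vi_solution C (op_RD F A b \<tau> (col (x k) (l k))) (col (x (Suc k)) (l (Suc k)))
          \<longleftrightarrow> x (Suc k) = closest_point (joint_set \<Omega>)
                             (x k - \<tau> *\<^sub>R (F (x k) + transpose A *v l k))
            \<and> l (Suc k) = closest_point nonneg_orthant
                             (l k + \<tau> *\<^sub>R (2 *\<^sub>R (A *v x (Suc k)) - A *v x k - b)))"
proof -
  let ?S = "joint_set \<Omega>"
  have S: "convex ?S" "closed ?S" "?S \<noteq> {}"
    \<comment> \<open>The Slater point is the witness that the joint set is nonempty.\<close>
    using slater
    by (auto simp: slater_def intro!: convex_joint_set closed_joint_set
        Omega_convex compact_imp_closed[OF Omega_compact])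
  note proj = vi_solution_op_RD_iff_projections[OF S tau, where A = A, folded C_def]
  \<comment> \<open>Existence and uniqueness are read off the projection formulas: the first fixes
    \<open>x'\<close> from the current iterate, and the second then fixes \<open>l'\<close>.\<close>
  have ex1: "\<exists>!w. vi_solution C (op_RD F A b \<tau> wk) w" for wk
  proof -
    obtain x l where wk: "wk = col x l" by (metis col_fst_snd)
    define x' where "x' = closest_point ?S (x - \<tau> *\<^sub>R (F x + transpose A *v l))"
    define l' where
      "l' = closest_point nonneg_orthant (l + \<tau> *\<^sub>R (2 *\<^sub>R (A *v x') - A *v x - b))"
    show ?thesis
    proof (rule ex1I[of _ "col x' l'"])
      show "vi_solution C (op_RD F A b \<tau> wk) (col x' l')"
        unfolding wk proj x'_def l'_def by blast
    next
      fix w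
      assume "vi_solution C (op_RD F A b \<tau> wk) w"
      then have "col_fst w = x' \<and> col_snd w = l'"
        using proj[of F b x l "col_fst w" "col_snd w"] by (simp add: wk x'_def l'_def)
      then show "w = col x' l'" by (metis col_fst_snd)
    qed
  qed
  have inv: "invertible D" using D_pos by (rule pos_def_invertible)
  \<comment> \<open>Both sides are the same inclusion in the normal cone, since \<open>op_RD\<close>
    is by definition R(w) + D(w' - w).\<close>
  have fb: "w' \<in> precond_fb D (op_of (op_R F A b)) (normal_cone C) w \<longleftrightarrow>
      vi_solution C (op_RD F A b \<tau> w) w'" for w w'
    by (simp only: mem_precond_fb_iff[OF inv] vi_solution_iff_normal_cone op_RD_def flip: D_def)
  \<comment> \<open>Uniqueness of the solution upgrades membership in the set-valued step to
    equality with a singleton.\<close>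
  have vi_fb: "vi_solution C (op_RD F A b \<tau> w) w' \<longleftrightarrow>
      precond_fb D (op_of (op_R F A b)) (normal_cone C) w = {w'}" for w w'
    using ex1[of w] fb[of _ w] by blast
  have kkt: "kkt_op ?S F A b = op_add (normal_cone C) (op_of (op_R F A b))"
    unfolding C_def by (rule kkt_op_eq_normal_cone_plus_op_R)
  show ?thesis
    by (intro conjI allI ex1 inv kkt vi_fb proj)
qed

end
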